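(* Let $f:(0,\infty)\to\mathbb{R}$ be continuously differentiable with $f(x)>0$ for all $x>0$, $f'(x)>0$ for all $x>x_1$ (for some $x_1\ge 0$), and $f'(x)\to 0$ as $x\to\infty$. Suppose in addition that $f'$ is decreasing on $[x_2,\infty)$ for some $x_2>0$. Let $\tau>0$, let $\mu$ be a positive finite Borel measure on $[-\tau,0]$, and put $$M:=\int_{[-\tau,0]}\mu(ds)\in(0,\infty),\qquad C:=\int_{[-\tau,0]}|s|\,\mu(ds),$$ with $C>0$. Let $\psi\in C([-\tau,0];(0,\infty))$ and let $x$ be the unique continuous solution of $$x'(t)=\int_{[-\tau,0]}\mu(ds)\,f(x(t+s)),\quad t>0;\qquad x(t)=\psi(t),\quad t\in[-\tau,0].$$ Let $F(x)=\int_1^x \frac{1}{f(u)}\,du$ for $x>0$. Then the following are equivalent: (a) $\displaystyle\lim_{x\to\infty}\frac{f(x)}{x/\log x}=0$; (b) $\displaystyle\lim_{t\to\infty}\frac{x(t)}{F^{-1}(Mt)}=1$.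
   Context: The function $F$ is strictly increasing and $F(x)\to\infty$ as $x\to\infty$ (since $f(x)/x\to0$), so $F^{-1}(Mt)$ is defined for all $t\ge0$. *)

theory Defs
  imports "HOL-Analysis.Analysis"
begin

text \<open>The interval integral is oriented, so \<open>F_fun f x\<close> is negative for \<open>0 < x < 1\<close>.\<close>

definition F_fun :: "(real \<Rightarrow> real) \<Rightarrow> real \<Rightarrow> real" where
  "F_fun f x = (LBINT u=ereal 1..ereal x. 1 / f u)"

definition F_inv :: "(real \<Rightarrow> real) \<Rightarrow> real \<Rightarrow> real" where
  "F_inv f = inv_into {0<..} (F_fun f)"

text \<open>A function \<open>f\<close> on the open half-line is modelled by a total function whose values outside
  \<open>{0<..}\<close> are irrelevant; accordingly a solution is required to take values in \<open>{0<..}\<close>.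
  With \<open>f\<close> positive there and \<open>\<psi>\<close> positive this is automatic, since no solution can reach 0.\<close>

definition delay_solution ::
  "(real \<Rightarrow> real) \<Rightarrow> real \<Rightarrow> real measure \<Rightarrow> (real \<Rightarrow> real) \<Rightarrow> (real \<Rightarrow> real) \<Rightarrow> bool" where
  "delay_solution f \<tau> \<mu> \<psi> x \<longleftrightarrow>
     continuous_on {-\<tau>..} x \<and>
     (\<forall>t\<ge>-\<tau>. 0 < x t) \<and>
     (\<forall>t\<in>{-\<tau>..0}. x t = \<psi> t) \<and>
     (\<forall>t>0. (x has_real_derivative (LINT s|\<mu>. f (x (t + s)))) (at t))"

end

theory Submission
  imports Defs
begin

text \<open>Put \<open>D t = M * t - F (x t)\<close>. The mean value theorem applied to \<open>f \<circ> x\<close> gives, for large \<open>t\<close>,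
  \<open>M * C * f' (x t) * f (x (t - 2 * \<tau>)) / f (x t) \<le> D' t \<le> M * C * f' (x (t - \<tau>))\<close>. Comparing with the
  derivative of \<open>ln (f (x t))\<close> shows that \<open>D t\<close> is bounded above by a multiple of \<open>ln (x t)\<close> and below by
  a multiple of \<open>ln (f (x t))\<close>, up to constants. With \<open>X t = F_inv f (M * t)\<close> one has
  \<open>D t = F (X t) - F (x t)\<close>. Under (a), \<open>F\<close> grows faster than any multiple of \<open>ln\<^sup>2\<close>, so the upper
  bound forces \<open>ln (X t / x t) \<longrightarrow> 0\<close>. Conversely \<open>D t \<le> \<bar>X t - x t\<bar> / f (x t)\<close>, so under (b) the lower
  bound gives \<open>f u * ln (f u) / u \<longrightarrow> 0\<close>; distinguishing \<open>f u < sqrt u\<close> from \<open>f u \<ge> sqrt u\<close>, this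
  yields (a).\<close>

section \<open>Calculus preliminaries\<close>

text \<open>The difference \<open>h - g\<close> has nonnegative derivative. This is the way
  differential inequalities are integrated throughout.\<close>

lemma deriv_le_imp_diff_le:
  fixes g h :: "real \<Rightarrow> real"
  assumes "a \<le> b"
    and "\<And>u. u \<in> {a..b} \<Longrightarrow> (g has_real_derivative g' u) (at u)"
    and "\<And>u. u \<in> {a..b} \<Longrightarrow> (h has_real_derivative h' u) (at u)"
    and "\<And>u. u \<in> {a..b} \<Longrightarrow> g' u \<le> h' u"
  shows "g b - g a \<le> h b - h a"
proof -
  have "h a - g a \<le> h b - g b"
    by (rule deriv_nonneg_imp_mono[where g' = "\<lambda>u. h' u - g' u"])
       (use assms in \<open>auto intro!: derivative_eq_intros\<close>)
  then show ?thesis by simp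
qed

text \<open>With \<open>v = sqrt u\<close> the quotient is \<open>2 * (ln v / v)\<close>.\<close>

lemma ln_over_sqrt_tendsto_0: "((\<lambda>u::real. ln u / sqrt u) \<longlongrightarrow> 0) at_top"
proof -
  have lim: "((\<lambda>u::real. 2 * (ln (sqrt u) / sqrt u)) \<longlongrightarrow> 2 * 0) at_top"
    by (intro tendsto_mult tendsto_const filterlim_compose[OF ln_x_over_x_tendsto_0 sqrt_at_top])
  have "\<forall>\<^sub>F u::real in at_top. 2 * (ln (sqrt u) / sqrt u) = ln u / sqrt u"
    using eventually_gt_at_top[of 0] by eventually_elim (simp add: ln_sqrt)
  from Lim_transform_eventually[OF lim this] show ?thesis by simp
qed

section \<open>The rate \<open>f\<close> and the primitive \<open>F\<close> of its
  reciprocal\<close>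

locale sublinear_rate =
  fixes f f' :: "real \<Rightarrow> real" and x1 x2 :: real
  assumes f_deriv: "\<And>u. 0 < u \<Longrightarrow> (f has_real_derivative f' u) (at u)"
    and f_pos: "\<And>u. 0 < u \<Longrightarrow> 0 < f u"
    and x1_nonneg: "0 \<le> x1"
    and f'_pos: "\<And>u. x1 < u \<Longrightarrow> 0 < f' u"
    and f'_lim: "(f' \<longlongrightarrow> 0) at_top"
    and f'_decreasing: "antimono_on {x2..} f'"
begin

abbreviation F :: "real \<Rightarrow> real" where "F \<equiv> F_fun f"

lemma f_cont: "continuous_on {0<..} f"
  by (auto intro!: DERIV_continuous_on DERIV_subset[OF f_deriv])

lemma f_mono: "x1 < a \<Longrightarrow> a \<le> b \<Longrightarrow> f a \<le> f b"
  by (rule deriv_nonneg_imp_mono[where g' = f'])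
     (use x1_nonneg f'_pos in \<open>auto intro!: f_deriv less_imp_le\<close>)

lemma f'_antimono: "x2 \<le> a \<Longrightarrow> a \<le> b \<Longrightarrow> f' b \<le> f' a"
  using f'_decreasing by (auto simp: monotone_on_def)

lemma f_over_id_tendsto_0: "((\<lambda>u. f u / u) \<longlongrightarrow> 0) at_top"
proof (rule lhospital_at_top_at_top[where f' = f' and g' = "\<lambda>_. 1"])
  show "\<forall>\<^sub>F u in at_top. (f has_real_derivative f' u) (at u)"
    by (auto intro!: eventually_mono[OF eventually_gt_at_top[of 0]] f_deriv)
qed (use f'_lim in \<open>auto simp: filterlim_ident\<close>)

lemma eventually_f_le_id: "\<forall>\<^sub>F u in at_top. f u \<le> u"
  using order_tendstoD(2)[OF f_over_id_tendsto_0 zero_less_one] eventually_gt_at_top[of 0]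
  by eventually_elim (auto simp: field_simps)

lemma F_deriv:
  assumes "0 < u"
  shows "(F has_real_derivative 1 / f u) (at u)"
proof -
  \<comment> \<open>The interval has both the base point 1 and \<open>u\<close> in its interior, so
    the one-sided cases \<open>u < 1\<close> and \<open>u > 1\<close> need no separation.\<close>
  define a b where "a = min u 1 / 2" and "b = max u 1 + 1"
  have ab: "0 < a" "a < 1" "1 < b" "a < u" "u < b"
    using assms by (auto simp: a_def b_def)
  have "continuous_on {a..b} (\<lambda>y. 1 / f y)"
    using ab f_pos
    by (intro continuous_intros continuous_on_subset[OF f_cont]) (force simp: less_imp_neq[symmetric])+
  from interval_integral_FTC2[of a 1 b, OF _ _ this, of u]
  have "(F has_vector_derivative 1 / f u) (at u within {a..b})"
    using ab by (simp add: F_fun_def[abs_def])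
  moreover have "at u within {a..b} = at u"
    using ab by (intro at_within_Icc_at)
  ultimately show ?thesis
    by (simp add: has_real_derivative_iff_has_vector_derivative)
qed

lemma F_mono: "0 < a \<Longrightarrow> a \<le> b \<Longrightarrow> F a \<le> F b"
  by (rule deriv_nonneg_imp_mono[where g' = "\<lambda>u. 1 / f u"])
     (auto intro!: F_deriv less_imp_le[OF f_pos])

text \<open>Eventually \<open>f u \<le> u\<close>, so \<open>F\<close> grows at least like
  \<open>ln\<close>.\<close>

lemma F_at_top: "filterlim F at_top at_top"
proof -
  from eventually_f_le_id obtain U where U: "\<And>u. u \<ge> U \<Longrightarrow> f u \<le> u"
    by (auto simp: eventually_at_top_linorder)
  define V where "V = max U 1"
  have "ln u - ln V \<le> F u - F V" if "u \<ge> V" for u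
    by (rule deriv_le_imp_diff_le[where g' = "\<lambda>u. 1 / u" and h' = "\<lambda>u. 1 / f u"])
       (use that U f_pos in \<open>auto intro!: derivative_eq_intros F_deriv divide_left_mono simp: V_def\<close>)
  then have "\<forall>\<^sub>F u in at_top. F V - ln V + ln u \<le> F u"
    by (auto intro!: eventually_mono[OF eventually_ge_at_top[of V]] simp: algebra_simps)
  moreover have "filterlim (\<lambda>u::real. F V - ln V + ln u) at_top at_top"
    by (intro filterlim_tendsto_add_at_top[OF tendsto_const] ln_at_top)
  ultimately show ?thesis
    by (rule filterlim_at_top_mono[rotated])
qed

text \<open>Since \<open>F 1 = 0\<close> and \<open>F\<close> is unbounded, the intermediate value
  theorem on some \<open>{1..b}\<close> supplies a preimage of \<open>y\<close>.\<close>

lemma F_inv_works: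
  assumes "0 \<le> y"
  shows "0 < F_inv f y" and "F (F_inv f y) = y"
proof -
  have "\<forall>\<^sub>F b in at_top. 1 \<le> b \<and> y \<le> F b"
    using F_at_top by (auto simp: filterlim_at_top eventually_ge_at_top eventually_conj)
  then obtain b where b: "1 \<le> b" "y \<le> F b"
    by (auto simp: eventually_at_top_linorder)
  have "F 1 = 0" by (simp add: F_fun_def)
  moreover have "continuous_on {1..b} F"
    by (auto intro!: DERIV_continuous_on DERIV_subset[OF F_deriv])
  ultimately obtain u where "1 \<le> u" "F u = y"
    using IVT'[of F 1 y b] assms b by auto
  then have "y \<in> F ` {0<..}" by force
  then show "0 < F_inv f y" "F (F_inv f y) = y"
    using inv_into_into[of y F "{0<..}"] f_inv_into_f[of y F "{0<..}"] by (auto simp: F_inv_def)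
qed

lemma F_inv_at_top: "filterlim (F_inv f) at_top at_top"
  unfolding filterlim_at_top_gt[of _ _ 0]
proof safe
  fix Z :: real assume "0 < Z"
  show "\<forall>\<^sub>F y in at_top. Z \<le> F_inv f y"
    using eventually_ge_at_top[of 0] eventually_gt_at_top[of "F Z"]
  proof eventually_elim
    case (elim y)
    with F_inv_works[of y] F_mono[of "F_inv f y" Z] show ?case by force
  qed
qed

text \<open>Beyond \<open>a\<close> the integrand is at most \<open>1 / f a\<close>, as
  \<open>f\<close> increases there. For \<open>b < a\<close> the left side is nonpositive, so
  \<open>b\<close> need not exceed \<open>x1\<close>.\<close>

lemma F_diff_le:
  assumes "0 < a" "x1 < a" "0 < b"
  shows "F b - F a \<le> \<bar>b - a\<bar> / f a"
proof (cases "a \<le> b")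
  case True
  have "F b - F a \<le> b / f a - a / f a"
    by (rule deriv_le_imp_diff_le[where g' = "\<lambda>u. 1 / f u" and h' = "\<lambda>_. 1 / f a"])
       (use assms True f_pos f_mono in
         \<open>auto intro!: derivative_eq_intros F_deriv divide_left_mono mult_pos_pos simp: less_imp_neq[symmetric]\<close>)
  with True show ?thesis by (simp add: diff_divide_distrib)
next
  case False
  with F_mono[of b a] assms f_pos[of a] show ?thesis
    by (smt (verit) divide_nonneg_nonneg)
qed

text \<open>For large \<open>u\<close> one has \<open>ln u / u \<le> \<epsilon> / f u\<close>;
  integrating from \<open>a\<close> to \<open>b\<close> gives half the difference of the squared
  logarithms on the left.\<close>

lemma F_diff_ge_ln:
  assumes lim: "((\<lambda>u. f u * ln u / u) \<longlongrightarrow> 0) at_top" and "0 < \<epsilon>"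
  shows "\<exists>U\<ge>exp 1. \<forall>a\<ge>U. \<forall>b\<ge>a. ln a * (ln b - ln a) \<le> \<epsilon> * (F b - F a)"
proof -
  have "\<forall>\<^sub>F u in at_top. f u * ln u / u < \<epsilon>"
    using order_tendstoD(2)[OF lim] \<open>0 < \<epsilon>\<close> .
  then obtain U0 where U0: "\<And>u. u \<ge> U0 \<Longrightarrow> f u * ln u / u < \<epsilon>"
    by (auto simp: eventually_at_top_linorder)
  define U where "U = max U0 (exp 1)"
  have U_pos: "u > 0" if "u \<ge> U" for u
    using that exp_gt_zero[of "1::real"] by (simp add: U_def del: exp_gt_zero)
  have "ln a * (ln b - ln a) \<le> \<epsilon> * (F b - F a)" if "a \<ge> U" "b \<ge> a" for a b
  proof -
    have "(ln b)\<^sup>2 / 2 - (ln a)\<^sup>2 / 2 \<le> \<epsilon> * F b - \<epsilon> * F a"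
    proof (rule deriv_le_imp_diff_le[where g' = "\<lambda>u. ln u / u" and h' = "\<lambda>u. \<epsilon> * (1 / f u)"])
      fix u assume u: "u \<in> {a..b}"
      then have "u > 0" "u \<ge> U0" using that U_pos[of u] by (auto simp: U_def)
      then show "((\<lambda>u. (ln u)\<^sup>2 / 2) has_real_derivative ln u / u) (at u)"
        by (auto intro!: derivative_eq_intros)
      show "((\<lambda>u. \<epsilon> * F u) has_real_derivative \<epsilon> * (1 / f u)) (at u)"
        using \<open>u > 0\<close> by (intro DERIV_cmult F_deriv)
      show "ln u / u \<le> \<epsilon> * (1 / f u)"
        using U0[OF \<open>u \<ge> U0\<close>] f_pos[OF \<open>u > 0\<close>] by (simp add: field_simps)
    qed (use that in auto)
    moreover have "ln a \<le> ln b"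
      using that U_pos[of a] by simp
    \<comment> \<open>This square is exactly the gap between the two sides of the next
      inequality.\<close>
    then have "0 \<le> (ln b - ln a)\<^sup>2 / 2" by simp
    then have "ln a * (ln b - ln a) \<le> (ln b)\<^sup>2 / 2 - (ln a)\<^sup>2 / 2"
      by (simp add: power2_eq_square field_simps)
    ultimately show ?thesis by (simp add: algebra_simps)
  qed
  then show ?thesis by (intro exI[of _ U]) (auto simp: U_def)
qed

text \<open>A one-sided bound suffices because the target is positive for \<open>u > 1\<close>; the
  constant \<open>K\<close> is absorbed by \<open>f u / u\<close> tending to 0.\<close>

lemma f_ln_over_id_tendsto_0:
  assumes "0 < c" and ev: "\<And>\<epsilon>. 0 < \<epsilon> \<Longrightarrow> \<forall>\<^sub>F u in at_top. f u * (c * ln (f u) - K) / u \<le> \<epsilon>"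
  shows "((\<lambda>u. f u * ln u / u) \<longlongrightarrow> 0) at_top"
proof (rule tendstoI)
  fix e :: real assume "0 < e"
  have "((\<lambda>u. K * (f u / u)) \<longlongrightarrow> K * 0) at_top"
    by (intro tendsto_intros f_over_id_tendsto_0)
  \<comment> \<open>This bound and the next both enter doubled, for a total of
    \<open>3 * c * e / 4\<close>.\<close>
  then have "\<forall>\<^sub>F u in at_top. K * (f u / u) < c * e / 4"
    using \<open>0 < e\<close> \<open>0 < c\<close> by (intro order_tendstoD(2)) auto
  moreover have "\<forall>\<^sub>F u in at_top. f u * (c * ln (f u) - K) / u \<le> c * e / 8"
    using \<open>0 < e\<close> \<open>0 < c\<close> by (intro ev) simp
  moreover have "\<forall>\<^sub>F u in at_top. ln u / sqrt u < e"
    using \<open>0 < e\<close> ln_over_sqrt_tendsto_0 by (intro order_tendstoD(2)) auto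
  ultimately show "\<forall>\<^sub>F u in at_top. dist (f u * ln u / u) 0 < e"
    using eventually_gt_at_top[of 1]
  proof eventually_elim
    case (elim u)
    have pos: "0 < f u" "0 < ln u" using elim f_pos by auto
    have "f u * ln u / u < e"
    proof (cases "f u < sqrt u")
      case True
      have "f u * ln u / u \<le> sqrt u * ln u / u"
        using True pos elim by (intro divide_right_mono mult_right_mono) auto
      also have "\<dots> = ln u / sqrt u"
        using elim by (simp add: field_simps)
      finally show ?thesis using elim by simp
    next
      case False
      then have "ln (sqrt u) \<le> ln (f u)" using elim pos by simp
      then have "c * ln u \<le> 2 * (c * ln (f u))"
        using elim \<open>0 < c\<close> by (simp add: ln_sqrt)
      then have "f u / u * (c * ln u) \<le> f u / u * (2 * (c * ln (f u)))"
        using pos elim by (intro mult_left_mono) auto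
      also have "\<dots> = 2 * (f u * (c * ln (f u) - K) / u) + 2 * (K * (f u / u))"
        by (simp add: algebra_simps add_divide_distrib diff_divide_distrib)
      also have "\<dots> < c * e"
        using elim mult_pos_pos[OF \<open>0 < c\<close> \<open>0 < e\<close>] by linarith
      finally have "c * (f u * ln u / u) < c * e" by (simp add: mult_ac)
      then show ?thesis using \<open>0 < c\<close> by (simp only: mult_less_cancel_left_pos)
    qed
    with pos elim show ?case by (simp add: dist_real_def)
  qed
qed

end

section \<open>The delay equation: monotonicity and divergence of the solution\<close>

locale sublinear_delay_equation = sublinear_rate f f' x1 x2
  for f f' :: "real \<Rightarrow> real" and x1 x2 :: real +
  fixes \<tau> :: real and \<mu> :: "real measure" and \<psi> x :: "real \<Rightarrow> real"
  assumes \<tau>_pos: "0 < \<tau>"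
    and \<mu>_finite: "finite_measure \<mu>"
    and \<mu>_borel: "sets \<mu> = sets (restrict_space borel {-\<tau>..0})"
    and M_pos: "0 < (LINT s|\<mu>. (1::real))"
    and C_pos: "0 < (LINT s|\<mu>. \<bar>s\<bar>)"
    and x_solution: "delay_solution f \<tau> \<mu> \<psi> x"
begin

definition M :: real where "M = (LINT s|\<mu>. 1)"
definition C :: real where "C = (LINT s|\<mu>. \<bar>s\<bar>)"
definition dx :: "real \<Rightarrow> real" where "dx t = (LINT s|\<mu>. f (x (t + s)))"

lemma MC_pos: "0 < M" "0 < C"
  using M_pos C_pos by (auto simp: M_def C_def)

lemma x_cont: "continuous_on {-\<tau>..} x"
  and x_pos: "-\<tau> \<le> t \<Longrightarrow> 0 < x t"
  and x_deriv: "0 < t \<Longrightarrow> (x has_real_derivative dx t) (at t)"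
  using x_solution by (auto simp: delay_solution_def dx_def)

lemma space_\<mu>: "space \<mu> = {-\<tau>..0}"
  using sets_eq_imp_space_eq[OF \<mu>_borel] by (simp add: space_restrict_space)

lemma integrable_\<mu>:
  fixes g :: "real \<Rightarrow> real"
  assumes "continuous_on {-\<tau>..0} g"
  shows "integrable \<mu> g"
proof -
  have "bounded (g ` {-\<tau>..0})"
    by (intro compact_imp_bounded compact_continuous_image assms) simp
  then obtain B where "\<forall>s\<in>{-\<tau>..0}. norm (g s) \<le> B"
    by (auto simp: bounded_iff)
  moreover have "g \<in> borel_measurable \<mu>"
    using borel_measurable_continuous_on_restrict[OF assms]
      measurable_cong_sets[OF \<mu>_borel refl, of "borel :: real measure"] by simp
  ultimately show ?thesis
    by (intro finite_measure.integrable_const_bound[OF \<mu>_finite, of _ B])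
       (auto intro!: AE_I2 simp: space_\<mu>)
qed

lemma integrable_dx: "0 \<le> t \<Longrightarrow> integrable \<mu> (\<lambda>s. f (x (t + s)))"
proof (rule integrable_\<mu>)
  assume "0 \<le> t"
  then show "continuous_on {-\<tau>..0} (\<lambda>s. f (x (t + s)))"
    by (intro continuous_on_compose2[OF f_cont] continuous_on_compose2[OF x_cont] continuous_intros)
       (auto intro!: x_pos)
qed

lemma dx_le:
  assumes "0 \<le> t" "\<And>s. s \<in> {-\<tau>..0} \<Longrightarrow> f (x (t + s)) \<le> B"
  shows "dx t \<le> M * B"
proof -
  have "dx t \<le> (LINT s|\<mu>. 1 * B)"
    unfolding dx_def using assms
    by (intro integral_mono integrable_dx integrable_\<mu>) (auto simp: space_\<mu>)
  also have "\<dots> = M * B" unfolding M_def by (rule integral_mult_left_zero)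
  finally show ?thesis .
qed

lemma dx_ge:
  assumes "0 \<le> t" "\<And>s. s \<in> {-\<tau>..0} \<Longrightarrow> B \<le> f (x (t + s))"
  shows "M * B \<le> dx t"
proof -
  have "M * B = (LINT s|\<mu>. 1 * B)" unfolding M_def by (rule integral_mult_left_zero[symmetric])
  also have "\<dots> \<le> dx t"
    unfolding dx_def using assms
    by (intro integral_mono integrable_dx integrable_\<mu>) (auto simp: space_\<mu>)
  finally show ?thesis .
qed

text \<open>The right-hand side is nonnegative by positivity of \<open>f\<close>. The range starts
  at 0 because the initial function may oscillate.\<close>

lemma x_mono:
  assumes "0 \<le> a" "a \<le> b"
  shows "x a \<le> x b"
proof (rule DERIV_nonneg_imp_increasing_open[OF \<open>a \<le> b\<close>])
  show "continuous_on {a..b} x"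
    by (rule continuous_on_subset[OF x_cont]) (use assms \<tau>_pos in auto)
  fix t assume "a < t"
  then have "0 < t" using assms by simp
  moreover have "M * 0 \<le> dx t"
    using \<open>0 < t\<close> by (intro dx_ge less_imp_le[OF f_pos] x_pos) auto
  ultimately show "\<exists>y. (x has_real_derivative y) (at t) \<and> 0 \<le> y"
    using x_deriv by auto
qed

text \<open>A bounded solution would stay in a compact subset of the positive axis, where
  \<open>f\<close> has a positive minimum, and so would grow linearly.\<close>

lemma x_at_top: "filterlim x at_top at_top"
proof -
  have "\<exists>t\<ge>0. Z \<le> x t" for Z
  proof (rule ccontr)
    assume "\<not> ?thesis"
    then have bd: "x t \<in> {x 0..Z}" if "0 \<le> t" for t
      using that x_mono[of 0 t] by force
    have x0: "0 < x 0" using x_pos[of 0] \<tau>_pos by simp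
    have "\<exists>v\<in>{x 0..Z}. \<forall>u\<in>{x 0..Z}. f v \<le> f u"
      using bd[of 0] x0 by (intro continuous_attains_inf continuous_on_subset[OF f_cont]) auto
    then obtain v where v: "v \<in> {x 0..Z}" "\<And>u. u \<in> {x 0..Z} \<Longrightarrow> f v \<le> f u" by blast
    have m: "0 < M * f v" using v x0 f_pos MC_pos by auto
    \<comment> \<open>From time \<tau> on all delayed arguments are nonnegative, so
      \<open>bd\<close> applies to them.\<close>
    have lin: "M * f v * t - M * f v * \<tau> \<le> x t - x \<tau>" if "\<tau> \<le> t" for t
    proof (rule deriv_le_imp_diff_le[where g' = "\<lambda>_. M * f v" and h' = dx])
      fix u assume u: "u \<in> {\<tau>..t}"
      show "M * f v \<le> dx u"
        using u \<tau>_pos by (intro dx_ge v bd) auto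
      show "(x has_real_derivative dx u) (at u)"
        using u \<tau>_pos by (intro x_deriv) auto
    qed (use that in \<open>auto intro!: derivative_eq_intros\<close>)
    \<comment> \<open>Chosen so that the linear bound yields an increase of \<open>Z + 1\<close>
      after time \<tau>, beyond the ceiling \<open>Z\<close>.\<close>
    define t where "t = \<tau> + (Z + 1) / (M * f v)"
    have "0 < Z" using bd[of 0] x0 by simp
    then have "\<tau> \<le> t" using m by (simp add: t_def)
    have "M * f v * t - M * f v * \<tau> = Z + 1"
      unfolding right_diff_distrib[symmetric] t_def using less_imp_neq[OF m] by simp
    with lin[OF \<open>\<tau> \<le> t\<close>] bd[of t] x_pos[of \<tau>] \<open>\<tau> \<le> t\<close> \<tau>_pos show False by auto
  qed
  then show ?thesis
    unfolding filterlim_at_top eventually_at_top_linorder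
    by (meson x_mono order_trans)
qed

section \<open>Two-sided estimates of the defect\<close>

text \<open>The \<open>D\<close> of the overview. It would be constant for the undelayed equation
  \<open>x' = M * f x\<close>.\<close>

definition defect :: "real \<Rightarrow> real" where "defect t = M * t - F (x t)"

text \<open>Three delays are kept in reserve: increments are taken over up to
  \<open>2 * \<tau>\<close>, and bounding \<open>dx\<close> looks back one more \<tau>. The two
  smallness conditions serve \<open>dx_ge_half\<close> and \<open>fx_le_double\<close>.\<close>

definition late :: "real \<Rightarrow> bool" where
  "late T \<longleftrightarrow> 3 * \<tau> \<le> T \<and> (\<forall>t\<ge>T - 3 * \<tau>. x1 < x t \<and> x2 \<le> x t \<and> f (x t) \<le> x t \<and>
     f' (x t) * C \<le> 1/2 \<and> f' (x t) * (2 * \<tau> * M) \<le> 1/2)"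

lemma ex_late: "\<exists>T. late T"
proof -
  have 1: "\<forall>\<^sub>F u in at_top. f' u * k \<le> 1/2" for k
  proof -
    have "((\<lambda>u. f' u * k) \<longlongrightarrow> 0 * k) at_top" by (intro tendsto_intros f'_lim)
    from order_tendstoD(2)[OF this, of "1/2"] show ?thesis
      by (auto elim: eventually_mono)
  qed
  have "\<forall>\<^sub>F u in at_top. x1 < u \<and> x2 \<le> u \<and> f u \<le> u \<and> f' u * C \<le> 1/2 \<and> f' u * (2 * \<tau> * M) \<le> 1/2"
    by (intro eventually_conj 1 eventually_gt_at_top eventually_ge_at_top eventually_f_le_id)
  then have "\<forall>\<^sub>F t in at_top. x1 < x t \<and> x2 \<le> x t \<and> f (x t) \<le> x t \<and>
      f' (x t) * C \<le> 1/2 \<and> f' (x t) * (2 * \<tau> * M) \<le> 1/2"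
    using x_at_top by (rule eventually_compose_filterlim)
  then obtain t0 where t0: "\<forall>t\<ge>t0. x1 < x t \<and> x2 \<le> x t \<and> f (x t) \<le> x t \<and>
      f' (x t) * C \<le> 1/2 \<and> f' (x t) * (2 * \<tau> * M) \<le> 1/2"
    by (auto simp: eventually_at_top_linorder)
  have "late (max 0 t0 + 3 * \<tau>)"
    unfolding late_def using t0 by auto
  then show ?thesis ..
qed

context
  fixes T assumes late_T: "late T"
begin

lemma T_ge: "3 * \<tau> \<le> T" "0 < T"
  using late_T \<tau>_pos by (auto simp: late_def)

lemma late_bounds:
  assumes "T - 3 * \<tau> \<le> t"
  shows "x1 < x t" "x2 \<le> x t" "f (x t) \<le> x t"
    "f' (x t) * C \<le> 1/2" "f' (x t) * (2 * \<tau> * M) \<le> 1/2"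
    "0 < x t" "0 < f (x t)" "0 < f' (x t)"
  using late_T assms x1_nonneg f'_pos[of "x t"] f_pos[of "x t"] by (auto simp: late_def)

lemma fx_mono: "T - 3 * \<tau> \<le> a \<Longrightarrow> a \<le> b \<Longrightarrow> f (x a) \<le> f (x b)"
  using T_ge by (intro f_mono late_bounds x_mono) auto

lemma f'x_antimono: "T - 3 * \<tau> \<le> a \<Longrightarrow> a \<le> b \<Longrightarrow> f' (x b) \<le> f' (x a)"
  using T_ge by (intro f'_antimono late_bounds x_mono) auto

lemma dx_bounds:
  assumes "T - 2 * \<tau> \<le> t"
  shows "dx t \<le> M * f (x t)" and "M * f (x (t - \<tau>)) \<le> dx t"
  using assms T_ge \<tau>_pos by (auto intro!: dx_le dx_ge fx_mono)

lemma fx_deriv: "T - 2 * \<tau> \<le> t \<Longrightarrow> ((\<lambda>t. f (x t)) has_real_derivative f' (x t) * dx t) (at t)"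
  using T_ge \<tau>_pos by (intro DERIV_chain2[OF f_deriv] x_deriv late_bounds) auto

text \<open>On \<open>{a..t}\<close> the factor \<open>f' (x v)\<close> decreases, while
  \<open>dx v\<close> lies between \<open>M * f (x (a - \<tau>))\<close> and
  \<open>M * f (x t)\<close>. Freezing each factor at its extreme value leaves a linear comparison
  function.\<close>

lemma fx_diff_bounds:
  assumes "T - 2 * \<tau> \<le> a" "a \<le> t"
  shows "f (x t) - f (x a) \<le> f' (x a) * (M * f (x t)) * (t - a)" (is ?upper)
    and "f' (x t) * (M * f (x (a - \<tau>))) * (t - a) \<le> f (x t) - f (x a)" (is ?lower)
proof -
  have bnd: "f' (x v) * dx v \<le> f' (x a) * (M * f (x t))"
            "f' (x t) * (M * f (x (a - \<tau>))) \<le> f' (x v) * dx v" if "v \<in> {a..t}" for v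
  proof -
    have v: "T - 2 * \<tau> \<le> v" "T - 3 * \<tau> \<le> v" "T - 3 * \<tau> \<le> a" "T - 3 * \<tau> \<le> t" "T - 3 * \<tau> \<le> a - \<tau>"
      using that assms \<tau>_pos by auto
    have "M * f (x v) \<le> M * f (x t)" "M * f (x (a - \<tau>)) \<le> M * f (x (v - \<tau>))"
      using that v MC_pos by (auto intro!: fx_mono)
    with dx_bounds[OF v(1)] have dx: "dx v \<le> M * f (x t)" "M * f (x (a - \<tau>)) \<le> dx v" by auto
    have f': "f' (x v) \<le> f' (x a)" "f' (x t) \<le> f' (x v)"
      using that v by (auto intro!: f'x_antimono)
    have pos: "0 \<le> M * f (x (a - \<tau>))" "0 \<le> f' (x v)" "0 \<le> f' (x a)" "0 \<le> f' (x t)"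
      using MC_pos late_bounds(7,8) v by (auto intro: less_imp_le mult_nonneg_nonneg)
    show "f' (x v) * dx v \<le> f' (x a) * (M * f (x t))"
      using dx f' pos by (intro mult_mono) auto
    show "f' (x t) * (M * f (x (a - \<tau>))) \<le> f' (x v) * dx v"
      using dx f' pos by (intro mult_mono) auto
  qed
  have d: "((\<lambda>v. f (x v)) has_real_derivative f' (x v) * dx v) (at v)" if "v \<in> {a..t}" for v
    using that assms by (intro fx_deriv) auto
  have l: "((\<lambda>v. k * v) has_real_derivative k) (at v)" for k v :: real
    by (auto intro!: derivative_eq_intros)
  show ?upper
    using deriv_le_imp_diff_le[OF \<open>a \<le> t\<close> d l bnd(1)] by (simp add: right_diff_distrib)
  show ?lower
    using deriv_le_imp_diff_le[OF \<open>a \<le> t\<close> l d bnd(2)] by (simp add: right_diff_distrib)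
qed

text \<open>The increment over \<open>2 * \<tau>\<close> is at most half of \<open>f (x t)\<close>.
  This removes the delay from the lower estimate of the defect.\<close>

lemma fx_le_double: "T \<le> t \<Longrightarrow> f (x t) \<le> 2 * f (x (t - 2 * \<tau>))"
proof -
  assume t: "T \<le> t"
  have "f (x t) - f (x (t - 2 * \<tau>)) \<le> (f' (x (t - 2 * \<tau>)) * (2 * \<tau> * M)) * f (x t)"
    using fx_diff_bounds(1)[of "t - 2 * \<tau>" t] t \<tau>_pos by (simp add: mult_ac)
  also have "\<dots> \<le> 1/2 * f (x t)"
    using t \<tau>_pos by (intro mult_right_mono late_bounds less_imp_le[OF late_bounds(7)]) auto
  finally show ?thesis by simp
qed

text \<open>The middle quantity is the integral of \<open>f (x t) - f (x (t + s))\<close>, an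
  increment over a time of length \<open>\<bar>s\<bar>\<close>; integrating that length against
  \<mu> produces \<open>C\<close>.\<close>

lemma defect_bounds:
  assumes "T \<le> t"
  shows "M * f (x t) - dx t \<le> C * (f' (x (t - \<tau>)) * (M * f (x t)))" (is ?upper)
    and "C * (f' (x t) * (M * f (x (t - 2 * \<tau>)))) \<le> M * f (x t) - dx t" (is ?lower)
proof -
  \<comment> \<open>The factor 1 is the integrand of \<open>M\<close>, kept so that the constant can
    be pulled out of the integral.\<close>
  have eq: "M * f (x t) - dx t = (LINT s|\<mu>. 1 * f (x t) - f (x (t + s)))"
    unfolding M_def dx_def integral_mult_left_zero[symmetric] using assms T_ge
    by (intro Bochner_Integration.integral_diff[symmetric] integrable_dx integrable_\<mu>) auto
  have eqC: "C * k = (LINT s|\<mu>. \<bar>s\<bar> * k)" for k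
    unfolding C_def by (rule integral_mult_left_zero[symmetric])
  have int: "integrable \<mu> (\<lambda>s. 1 * f (x t) - f (x (t + s)))"
    using assms T_ge by (intro Bochner_Integration.integrable_diff integrable_dx integrable_\<mu>) auto
  have intC: "integrable \<mu> (\<lambda>s. \<bar>s\<bar> * k)" for k
    by (intro integrable_\<mu> continuous_intros)
  show ?upper
    unfolding eq eqC
  proof (intro integral_mono int intC)
    fix s assume "s \<in> space \<mu>"
    then have s: "-\<tau> \<le> s" "s \<le> 0" by (auto simp: space_\<mu>)
    have "1 * f (x t) - f (x (t + s)) \<le> f' (x (t + s)) * (M * f (x t)) * \<bar>s\<bar>"
      using fx_diff_bounds(1)[of "t + s" t] s assms \<tau>_pos by simp
    also have "\<dots> \<le> f' (x (t - \<tau>)) * (M * f (x t)) * \<bar>s\<bar>"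
      using s assms \<tau>_pos MC_pos less_imp_le[OF late_bounds(7)[of t]]
      by (intro mult_right_mono f'x_antimono) auto
    finally show "1 * f (x t) - f (x (t + s)) \<le> \<bar>s\<bar> * (f' (x (t - \<tau>)) * (M * f (x t)))"
      by (simp add: mult_ac)
  qed
  show ?lower
    unfolding eq eqC
  proof (intro integral_mono int intC)
    fix s assume "s \<in> space \<mu>"
    then have s: "-\<tau> \<le> s" "s \<le> 0" by (auto simp: space_\<mu>)
    \<comment> \<open>Here \<open>s \<ge> -\<tau>\<close> gives
      \<open>t - 2 * \<tau> \<le> t + s - \<tau>\<close>, making the bound uniform in
      \<open>s\<close>.\<close>
    have "f' (x t) * (M * f (x (t - 2 * \<tau>))) * \<bar>s\<bar> \<le> f' (x t) * (M * f (x (t + s - \<tau>))) * \<bar>s\<bar>"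
      using s assms \<tau>_pos MC_pos less_imp_le[OF late_bounds(8)[of t]]
      by (intro mult_right_mono mult_left_mono fx_mono) auto
    also have "\<dots> \<le> 1 * f (x t) - f (x (t + s))"
      using fx_diff_bounds(2)[of "t + s" t] s assms \<tau>_pos by simp
    finally show "\<bar>s\<bar> * (f' (x t) * (M * f (x (t - 2 * \<tau>)))) \<le> 1 * f (x t) - f (x (t + s))"
      by (simp add: mult_ac)
  qed
qed

lemma dx_ge_half: "T \<le> t \<Longrightarrow> M / 2 \<le> dx t / f (x t)"
proof -
  assume t: "T \<le> t"
  then have pos: "0 < f (x t)" using \<tau>_pos by (intro late_bounds) auto
  have "M * f (x t) - dx t \<le> (f' (x (t - \<tau>)) * C) * (M * f (x t))"
    using defect_bounds(1)[OF t] by (simp add: mult_ac)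
  also have "\<dots> \<le> 1/2 * (M * f (x t))"
    using t \<tau>_pos MC_pos pos by (intro mult_right_mono late_bounds) auto
  finally show ?thesis using pos by (simp add: field_simps)
qed

lemma defect_deriv: "T \<le> t \<Longrightarrow> (defect has_real_derivative M - dx t / f (x t)) (at t)"
proof -
  assume "T \<le> t"
  then have "((\<lambda>t. F (x t)) has_real_derivative 1 / f (x t) * dx t) (at t)"
    using T_ge \<tau>_pos by (intro DERIV_chain2[OF F_deriv] x_deriv late_bounds) auto
  then show ?thesis
    unfolding defect_def[abs_def] by (auto intro!: derivative_eq_intros)
qed

lemma ln_fx_deriv:
  "T \<le> t \<Longrightarrow> ((\<lambda>t. ln (f (x t))) has_real_derivative f' (x t) * dx t / f (x t)) (at t)"
  using \<tau>_pos by (auto intro!: derivative_eq_intros fx_deriv late_bounds)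

text \<open>The derivative of the defect is at most \<open>M * C * f' (x (t - \<tau>))\<close>, so
  the logarithm is delayed by \<tau> too. The factor 2 offsets the 1/2 in \<open>dx_ge_half\<close>;
  starting at \<open>T + \<tau>\<close> keeps the delayed time beyond \<open>T\<close>.\<close>

lemma defect_le:
  assumes "T + \<tau> \<le> t"
  shows "defect t - defect (T + \<tau>) \<le> 2 * C * ln (f (x (t - \<tau>))) - 2 * C * ln (f (x (T + \<tau> - \<tau>)))"
proof (rule deriv_le_imp_diff_le[OF assms])
  fix u assume u: "u \<in> {T + \<tau>..t}"
  then show "(defect has_real_derivative M - dx u / f (x u)) (at u)"
    using \<tau>_pos by (intro defect_deriv) auto
  have "((\<lambda>u. ln (f (x (u + - \<tau>)))) has_real_derivative
      f' (x (u + - \<tau>)) * dx (u + - \<tau>) / f (x (u + - \<tau>))) (at u)"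
    using u by (intro iffD1[OF DERIV_shift[of "\<lambda>t. ln (f (x t))"]] ln_fx_deriv) auto
  then show "((\<lambda>u. 2 * C * ln (f (x (u - \<tau>)))) has_real_derivative
      2 * C * (f' (x (u - \<tau>)) * dx (u - \<tau>) / f (x (u - \<tau>)))) (at u)"
    by (intro DERIV_cmult) simp
  have pos: "0 < f (x u)" "0 < f' (x (u - \<tau>))" using u \<tau>_pos by (auto intro!: late_bounds)
  have "M - dx u / f (x u) \<le> C * f' (x (u - \<tau>)) * M"
    using defect_bounds(1)[of u] u \<tau>_pos pos by (simp add: field_simps)
  also have "\<dots> = 2 * C * f' (x (u - \<tau>)) * (M / 2)" by simp
  also have "\<dots> \<le> 2 * C * f' (x (u - \<tau>)) * (dx (u - \<tau>) / f (x (u - \<tau>)))"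
    using u pos MC_pos by (intro mult_left_mono dx_ge_half) auto
  finally show "M - dx u / f (x u) \<le> 2 * C * (f' (x (u - \<tau>)) * dx (u - \<tau>) / f (x (u - \<tau>)))"
    by simp
qed

text \<open>The factor 1/2 pays for replacing \<open>f (x (u - 2 * \<tau>))\<close> by
  \<open>f (x u)\<close> through \<open>fx_le_double\<close>.\<close>

lemma defect_ge:
  assumes "T \<le> t"
  shows "C / 2 * ln (f (x t)) - C / 2 * ln (f (x T)) \<le> defect t - defect T"
proof (rule deriv_le_imp_diff_le[OF assms])
  fix u assume u: "u \<in> {T..t}"
  then show "(defect has_real_derivative M - dx u / f (x u)) (at u)"
    by (intro defect_deriv) auto
  show "((\<lambda>u. C / 2 * ln (f (x u))) has_real_derivative
      C / 2 * (f' (x u) * dx u / f (x u))) (at u)"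
    using u by (intro DERIV_cmult ln_fx_deriv) simp
  have pos: "0 < f (x u)" "0 < f' (x u)" using u \<tau>_pos by (auto intro!: late_bounds)
  have "C / 2 * (f' (x u) * dx u) \<le> C / 2 * (f' (x u) * (M * f (x u)))"
    using u \<tau>_pos pos MC_pos by (intro mult_left_mono dx_bounds) auto
  also have "\<dots> \<le> C / 2 * (f' (x u) * (M * (2 * f (x (u - 2 * \<tau>)))))"
    using u pos MC_pos by (intro mult_left_mono fx_le_double) auto
  also have "\<dots> \<le> M * f (x u) - dx u"
    using defect_bounds(2)[of u] u by simp
  finally show "C / 2 * (f' (x u) * dx u / f (x u)) \<le> M - dx u / f (x u)"
    using pos by (simp add: field_simps)
qed

end

text \<open>The lower bound holds since \<open>f (x t)\<close> is nondecreasing at late times, the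
  upper one since \<open>f (x t) \<le> x t\<close>. Used to derive the ratio limit.\<close>

lemma defect_le_ln:
  "\<exists>K. \<forall>\<^sub>F t in at_top. -K \<le> M * t - F (x t) \<and> M * t - F (x t) \<le> K + 2 * C * ln (x t)"
proof -
  obtain T where T: "late T" using ex_late ..
  define K1 where "K1 = defect (T + \<tau>) - 2 * C * ln (f (x T))"
  define K where "K = max K1 (- defect T)"
  have "-K \<le> M * t - F (x t) \<and> M * t - F (x t) \<le> K + 2 * C * ln (x t)" if "T + \<tau> \<le> t" for t
  proof
    have pos: "0 < f (x T)" "0 < f (x (t - \<tau>))" "0 < f (x t)"
      using that \<tau>_pos by (auto intro!: late_bounds[OF T])
    have "f (x T) \<le> f (x t)" "f (x (t - \<tau>)) \<le> f (x t)"
      using that \<tau>_pos by (auto intro!: fx_mono[OF T])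
    moreover have "f (x t) \<le> x t"
      using that \<tau>_pos by (intro late_bounds[OF T]) auto
    ultimately have "ln (f (x T)) \<le> ln (f (x t))" "ln (f (x (t - \<tau>))) \<le> ln (x t)"
      using pos by simp_all
    then have 1: "C / 2 * ln (f (x T)) \<le> C / 2 * ln (f (x t))"
      and 2: "2 * C * ln (f (x (t - \<tau>))) \<le> 2 * C * ln (x t)"
      using MC_pos by simp_all
    show "-K \<le> M * t - F (x t)"
      using 1 defect_ge[OF T, of t] that \<tau>_pos by (simp add: K_def defect_def)
    show "M * t - F (x t) \<le> K + 2 * C * ln (x t)"
      using 2 defect_le[OF T, of t] that by (simp add: K_def K1_def defect_def)
  qed
  then show ?thesis by (auto simp: eventually_at_top_linorder)
qed

text \<open>Retains the logarithm in the lower bound, which the converse direction exploits.\<close>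

lemma defect_ge_ln: "\<exists>K. \<forall>\<^sub>F t in at_top. C / 2 * ln (f (x t)) - K \<le> M * t - F (x t)"
proof -
  obtain T where T: "late T" using ex_late ..
  have "C / 2 * ln (f (x t)) - (C / 2 * ln (f (x T)) - defect T) \<le> M * t - F (x t)" if "T \<le> t" for t
    using defect_ge[OF T that] by (simp add: defect_def)
  then show ?thesis by (auto simp: eventually_at_top_linorder)
qed

section \<open>The two implications\<close>

lemma Mt_at_top: "filterlim (\<lambda>t. M * t) at_top at_top"
  using MC_pos by (intro filterlim_tendsto_pos_mult_at_top[OF tendsto_const] filterlim_ident)

lemma ratio_tendsto_1:
  assumes lim: "((\<lambda>u. f u * ln u / u) \<longlongrightarrow> 0) at_top"
  shows "((\<lambda>t. x t / F_inv f (M * t)) \<longlongrightarrow> 1) at_top"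
proof -
  obtain K where K: "\<forall>\<^sub>F t in at_top. -K \<le> M * t - F (x t) \<and> M * t - F (x t) \<le> K + 2 * C * ln (x t)"
    using defect_le_ln ..
  \<comment> \<open>Makes \<open>\<bar>K\<bar> + 2 * C * ln a \<le> B * ln a\<close> once
    \<open>ln a \<ge> 1\<close>, which \<open>U \<ge> exp 1\<close> guarantees.\<close>
  define B where "B = \<bar>K\<bar> + 2 * C + 1"
  have B: "0 < B" using MC_pos by (simp add: B_def)
  have "((\<lambda>t. ln (x t) - ln (F_inv f (M * t))) \<longlongrightarrow> 0) at_top"
  proof (rule tendstoI)
    fix e :: real assume "0 < e"
    define \<epsilon> where "\<epsilon> = e / (2 * B)"
    have \<epsilon>: "0 < \<epsilon>" "\<epsilon> * B < e" using \<open>0 < e\<close> B by (auto simp: \<epsilon>_def)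
    obtain U where U: "exp 1 \<le> U"
        "\<And>a b. U \<le> a \<Longrightarrow> a \<le> b \<Longrightarrow> ln a * (ln b - ln a) \<le> \<epsilon> * (F b - F a)"
      using F_diff_ge_ln[OF lim \<open>0 < \<epsilon>\<close>] by blast
    \<comment> \<open>Stated for an ordered pair so that it serves both orders of \<open>x t\<close>
      and \<open>F_inv f (M * t)\<close>; the factor \<open>ln a\<close> cancels.\<close>
    have gap: "0 \<le> ln b - ln a \<and> ln b - ln a \<le> \<epsilon> * B"
      if "U \<le> a" "a \<le> b" "F b - F a \<le> \<bar>K\<bar> + 2 * C * ln a" for a b
    proof
      have "exp 1 \<le> a" using U that by simp
      then have a: "0 < a" "1 \<le> ln a"
        using exp_gt_zero[of "1::real"] by (linarith, simp add: ln_ge_iff less_le_trans[OF exp_gt_zero])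
      have "\<bar>K\<bar> + 2 * C * ln a \<le> B * ln a"
        using a MC_pos mult_left_mono[of 1 "ln a" "\<bar>K\<bar>"] by (simp add: B_def algebra_simps)
      then have "\<epsilon> * (F b - F a) \<le> \<epsilon> * (B * ln a)"
        using that \<epsilon> by (intro mult_left_mono) auto
      with U(2)[OF that(1,2)] have "ln a * (ln b - ln a) \<le> ln a * (\<epsilon> * B)"
        by (simp add: mult_ac)
      then show "ln b - ln a \<le> \<epsilon> * B"
        by (rule mult_left_le_imp_le) (use a in linarith)
      show "0 \<le> ln b - ln a" using a that by simp
    qed
    have "\<forall>\<^sub>F t in at_top. U \<le> x t"
      using x_at_top by (simp add: filterlim_at_top)
    moreover have "\<forall>\<^sub>F t in at_top. U \<le> F_inv f (M * t)"
      using filterlim_compose[OF F_inv_at_top Mt_at_top] by (simp add: filterlim_at_top)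
    ultimately show "\<forall>\<^sub>F t in at_top. dist (ln (x t) - ln (F_inv f (M * t))) 0 < e"
      using K eventually_ge_at_top[of 0]
    proof eventually_elim
      case (elim t)
      define X where "X = F_inv f (M * t)"
      have FX: "F X = M * t"
        using F_inv_works[of "M * t"] elim MC_pos by (simp add: X_def)
      have UX: "U \<le> X" using elim by (simp add: X_def)
      have "\<bar>ln (x t) - ln X\<bar> \<le> \<epsilon> * B"
      proof (cases "x t \<le> X")
        case True
        then have "F X - F (x t) \<le> \<bar>K\<bar> + 2 * C * ln (x t)" using elim FX by linarith
        from gap[OF _ True this] elim show ?thesis by simp
      next
        case False
        have "1 \<le> X" using UX U(1) exp_ge_add_one_self[of 1] by linarith
        \<comment> \<open>In this case the constant lower bound on the defect is enough; the
          logarithm is added only to match the form of \<open>gap\<close>.\<close>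
        then have "0 \<le> 2 * C * ln X" using MC_pos by simp
        then have "F (x t) - F X \<le> \<bar>K\<bar> + 2 * C * ln X" using elim FX by linarith
        from gap[OF UX _ this] False show ?thesis by simp
      qed
      with \<epsilon> show ?case by (simp add: dist_real_def X_def)
    qed
  qed
  then have "((\<lambda>t. exp (ln (x t) - ln (F_inv f (M * t)))) \<longlongrightarrow> exp 0) at_top"
    by (rule tendsto_exp)
  moreover have "\<forall>\<^sub>F t in at_top. exp (ln (x t) - ln (F_inv f (M * t))) = x t / F_inv f (M * t)"
    using eventually_ge_at_top[of 0]
  proof eventually_elim
    case (elim t)
    then have "0 < F_inv f (M * t)" "0 < x t"
      using F_inv_works(1)[of "M * t"] MC_pos x_pos[of t] \<tau>_pos by auto
    then show ?case by (simp add: exp_diff)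
  qed
  ultimately show ?thesis by (simp add: tendsto_cong)
qed

lemma f_ln_tendsto_0_if_ratio:
  assumes lim: "((\<lambda>t. x t / F_inv f (M * t)) \<longlongrightarrow> 1) at_top"
  shows "((\<lambda>u. f u * ln u / u) \<longlongrightarrow> 0) at_top"
proof -
  obtain K where K: "\<forall>\<^sub>F t in at_top. C / 2 * ln (f (x t)) - K \<le> M * t - F (x t)"
    using defect_ge_ln ..
  \<comment> \<open>The ratio is inverted because \<open>F_diff_le\<close>, based at
    \<open>x t\<close>, yields an error relative to \<open>x t\<close>.\<close>
  have "((\<lambda>t. \<bar>inverse (x t / F_inv f (M * t)) - 1\<bar>) \<longlongrightarrow> \<bar>inverse 1 - 1\<bar>) at_top"
    by (intro tendsto_intros lim) simp
  then have lim': "((\<lambda>t. \<bar>F_inv f (M * t) / x t - 1\<bar>) \<longlongrightarrow> 0) at_top" by simp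
  show ?thesis
  proof (rule f_ln_over_id_tendsto_0)
    show "0 < C / 2" using MC_pos by simp
    fix \<epsilon> :: real assume "0 < \<epsilon>"
    have "\<forall>\<^sub>F t in at_top. x1 < x t"
      using x_at_top by (simp add: filterlim_at_top_dense)
    moreover have "\<forall>\<^sub>F t in at_top. \<bar>F_inv f (M * t) / x t - 1\<bar> < \<epsilon>"
      using order_tendstoD(2)[OF lim' \<open>0 < \<epsilon>\<close>] .
    ultimately have "\<forall>\<^sub>F t in at_top. f (x t) * (C / 2 * ln (f (x t)) - K) / x t \<le> \<epsilon>"
      using K eventually_ge_at_top[of 0]
    proof eventually_elim
      case (elim t)
      define X where "X = F_inv f (M * t)"
      have X: "F X = M * t" "0 < X"
        using F_inv_works[of "M * t"] elim MC_pos by (auto simp: X_def)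
      have pos: "0 < x t" "0 < f (x t)" using x_pos[of t] elim \<tau>_pos f_pos by auto
      have "C / 2 * ln (f (x t)) - K \<le> \<bar>X - x t\<bar> / f (x t)"
        using elim X pos F_diff_le[of "x t" X] by simp
      then have "f (x t) * (C / 2 * ln (f (x t)) - K) \<le> \<bar>X - x t\<bar>"
        using pos by (simp add: field_simps)
      then have "f (x t) * (C / 2 * ln (f (x t)) - K) / x t \<le> \<bar>X - x t\<bar> / x t"
        using pos by (intro divide_right_mono) auto
      also have "\<dots> = \<bar>(X - x t) / x t\<bar>" using pos by simp
      also have "(X - x t) / x t = X / x t - 1" using pos by (simp add: diff_divide_distrib)
      finally show ?case using elim by (simp add: X_def)
    qed
    then obtain T0 where T0: "\<And>t. T0 \<le> t \<Longrightarrow> f (x t) * (C / 2 * ln (f (x t)) - K) / x t \<le> \<epsilon>"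
      by (auto simp: eventually_at_top_linorder)
    define T where "T = max 0 T0"
    \<comment> \<open>Passes from time to space: by continuity and divergence of \<open>x\<close>,
      every \<open>u \<ge> x T\<close> equals \<open>x t\<close> for some
      \<open>t \<ge> T\<close>.\<close>
    have "f u * (C / 2 * ln (f u) - K) / u \<le> \<epsilon>" if u: "x T \<le> u" for u
    proof -
      have "\<forall>\<^sub>F t in at_top. T \<le> t \<and> u \<le> x t"
        using x_at_top by (auto simp: filterlim_at_top eventually_ge_at_top eventually_conj)
      then obtain b where b: "T \<le> b" "u \<le> x b"
        by (auto simp: eventually_at_top_linorder)
      have "continuous_on {T..b} x"
        by (rule continuous_on_subset[OF x_cont]) (use \<tau>_pos in \<open>auto simp: T_def\<close>)
      then obtain t where "T \<le> t" "x t = u"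
        using IVT'[of x T u b] u b by auto
      then show ?thesis using T0[of t] by (auto simp: T_def)
    qed
    then show "\<forall>\<^sub>F u in at_top. f u * (C / 2 * ln (f u) - K) / u \<le> \<epsilon>"
      by (auto simp: eventually_at_top_linorder)
  qed
qed

end

theorem theorem3:
  fixes f f' \<psi> x :: "real \<Rightarrow> real"
    and x1 x2 \<tau> M C :: real
    and \<mu> :: "real measure"
  assumes f_deriv: "\<And>u. 0 < u \<Longrightarrow> (f has_real_derivative f' u) (at u)"
    and f'_cont: "continuous_on {0<..} f'"
    and f_pos: "\<And>u. 0 < u \<Longrightarrow> 0 < f u"
    and x1_nonneg: "0 \<le> x1"
    and f'_pos: "\<And>u. x1 < u \<Longrightarrow> 0 < f' u"
    and f'_lim: "(f' \<longlongrightarrow> 0) at_top"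
    and x2_pos: "0 < x2"
    and f'_decreasing: "antimono_on {x2..} f'"
    and \<tau>_pos: "0 < \<tau>"
    and \<mu>_finite: "finite_measure \<mu>"
    and \<mu>_borel: "sets \<mu> = sets (restrict_space borel {-\<tau>..0})"
    and M_eq: "M = (LINT s|\<mu>. 1)"
    and M_pos: "0 < M"
    and C_eq: "C = (LINT s|\<mu>. \<bar>s\<bar>)"
    and C_pos: "0 < C"
    and \<psi>_cont: "continuous_on {-\<tau>..0} \<psi>"
    and \<psi>_pos: "\<And>t. t \<in> {-\<tau>..0} \<Longrightarrow> 0 < \<psi> t"
    and x_solution: "delay_solution f \<tau> \<mu> \<psi> x"
  shows "((\<lambda>u. f u / (u / ln u)) \<longlongrightarrow> 0) at_top \<longleftrightarrow>
         ((\<lambda>t. x t / F_inv f (M * t)) \<longlongrightarrow> 1) at_top"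
proof -
  interpret E: sublinear_delay_equation f f' x1 x2 \<tau> \<mu> \<psi> x
    by (intro sublinear_delay_equation.intro sublinear_rate.intro sublinear_delay_equation_axioms.intro)
      (fact assms M_pos[unfolded M_eq] C_pos[unfolded C_eq])+
  have "M = E.M" by (simp add: M_eq E.M_def)
  then show ?thesis
    using E.ratio_tendsto_1 E.f_ln_tendsto_0_if_ratio by (auto simp only: divide_divide_eq_right)
qed

end
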